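(* There is a constant $c=c(d)$, depending only on $d$, such that the following hold for every convex body $C\subset\mathbb{R}^d$. (i) For every positive integer $k$ and every finite non-$\frac{k}{2}/C$-degenerate set $S\subset\mathbb{R}^d$ with $|S|\ge k$, we have $f(C,k,S)\le c\,\frac{|S|}{k}$. (ii) For every real $k>0$ and every $C$-nice measure $\mu$ with $\mu(\mathbb{R}^d)\ge k$, we have $f(C,k,\mu)\le c\,\frac{\mu(\mathbb{R}^d)}{k}$.
   Context: A convex body is a convex compact set with nonempty interior. A homothet of $C$ is a set $\lambda C+x$ with $x\in\mathbb{R}^d$, $\lambda>0$. A set $S$ is non-$t/C$-degenerate if the boundary of every homothet of $C$ contains at most $t$ points of $S$. Measures are Borel measures on $\mathbb{R}^d$ finite on compact sets; $\mu$ is non-$C$-degenerate if it vanishes on the boundary of every homothet of $C$, and $C$-nice if it is finite, non-$C$-degenerate, and there is a ball $K$ with $\mu(K)=\mu(\mathbb{R}^d)$ (fix such a $K$). A $k^-/S$-homothet is a homothet of $C$ containing at most $k$ points of $S$; a $k^-/\mu$-homothet is a homothet of $C$ of $\mu$-measure at most $k$. $f(C,k,S)$ is the least number of $k^-/S$-homothets of $C$ whose union covers $S$; $f(C,k,\mu)$ is the least number of $k^-/\mu$-homothets of $C$ whose union covers $K$. *)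

theory Defs
  imports "HOL-Analysis.Analysis" "HOL-Probability.Probability"
begin

definition convex_body :: "'a::euclidean_space set \<Rightarrow> bool" where
  "convex_body C \<longleftrightarrow> convex C \<and> compact C \<and> interior C \<noteq> {}"

definition homothet :: "'a::euclidean_space set \<Rightarrow> real \<Rightarrow> 'a \<Rightarrow> 'a set" where
  "homothet C l x = (\<lambda>y. l *\<^sub>R y + x) ` C"

definition is_homothet :: "'a::euclidean_space set \<Rightarrow> 'a set \<Rightarrow> bool" where
  "is_homothet C H \<longleftrightarrow> (\<exists>l x. l > 0 \<and> H = homothet C l x)"

definition non_degenerate_set :: "'a::euclidean_space set \<Rightarrow> real \<Rightarrow> 'a set \<Rightarrow> bool" where
  "non_degenerate_set C t S \<longleftrightarrow>
     (\<forall>H. is_homothet C H \<longrightarrow> real (card (S \<inter> frontier H)) \<le> t)"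

definition non_degenerate_measure :: "'a::euclidean_space set \<Rightarrow> 'a measure \<Rightarrow> bool" where
  "non_degenerate_measure C \<mu> \<longleftrightarrow>
     (\<forall>H. is_homothet C H \<longrightarrow> emeasure \<mu> (frontier H) = 0)"

definition nice_measure :: "'a::euclidean_space set \<Rightarrow> 'a measure \<Rightarrow> 'a set \<Rightarrow> bool" where
  "nice_measure C \<mu> K \<longleftrightarrow>
     sets \<mu> = sets borel \<and> emeasure \<mu> (space \<mu>) < \<infinity> \<and>
     non_degenerate_measure C \<mu> \<and>
     (\<exists>z r. r > 0 \<and> K = cball z r) \<and> emeasure \<mu> K = emeasure \<mu> (space \<mu>)"

definition f_set :: "'a::euclidean_space set \<Rightarrow> nat \<Rightarrow> 'a set \<Rightarrow> nat" where
  "f_set C k S = (LEAST n. \<exists>F. finite F \<and> card F = n \<and>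
      (\<forall>H\<in>F. is_homothet C H \<and> card (S \<inter> H) \<le> k) \<and> S \<subseteq> \<Union>F)"

definition f_meas :: "'a::euclidean_space set \<Rightarrow> real \<Rightarrow> 'a measure \<Rightarrow> 'a set \<Rightarrow> nat" where
  "f_meas C k \<mu> K = (LEAST n. \<exists>F. finite F \<and> card F = n \<and>
      (\<forall>H\<in>F. is_homothet C H \<and> emeasure \<mu> H \<le> ennreal k) \<and> K \<subseteq> \<Union>F)"

end

theory Submission
  imports Defs
begin

text \<open>
  By Helly's theorem, \<open>C\<close> has a centre with respect to which \<open>-C \<subseteq> d C\<close>; the gauge \<open>g\<close> of \<open>C\<close> at
  that centre is an asymmetric norm with \<open>g (-x) \<le> d g x\<close>. Around every point \<open>x\<close> to be covered there
  is a \<open>g\<close>-ball of mass between \<open>k/2\<close> and \<open>k\<close>: non-degeneracy prevents the mass from jumping over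
  this range as the radius grows. A Besicovitch-type greedy selection, which always picks an
  uncovered centre whose radius is at least half the supremum, produces balls covering no point more
  than a constant (depending on \<open>d\<close>) number of times. Hence the selection stops after at most
  constant times total mass over \<open>k\<close> steps, and then everything is covered.

  For the multiplicity bound let \<open>z\<close> lie in all the balls \<open>B(x\<^sub>i, r\<^sub>i)\<close> and put \<open>p\<^sub>i = z - x\<^sub>i\<close>. By a
  volume argument, the unit ball of \<open>g\<close> is covered by boundedly many small cells. If the
  directions \<open>p\<^sub>i / g p\<^sub>i\<close> and \<open>p\<^sub>j / g p\<^sub>j\<close> with \<open>i < j\<close> lie in the same cell, then
  \<open>g p\<^sub>j \<ge> g p\<^sub>i + r\<^sub>i / (2 d)\<close>; as \<open>g p\<^sub>j \<le> r\<^sub>j \<le> 2 r\<^sub>i\<close>, each cell contains at most \<open>4 d + 1\<close> directions.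
\<close>

subsection \<open>Asymmetric norms\<close>

text \<open>\<open>D\<close> measures the asymmetry and is the parameter that enters the
  quantitative bounds. \<open>B\<close> compares \<open>g\<close> with the Euclidean norm and
  depends on the body; it serves only continuity, compactness, boundedness and positivity.\<close>

locale asymmetric_norm =
  fixes g :: "'a::euclidean_space \<Rightarrow> real" and D B :: real
  assumes add: "g (x + y) \<le> g x + g y"
    and scale: "0 \<le> t \<Longrightarrow> g (t *\<^sub>R x) = t * g x"
    and neg: "g (- x) \<le> D * g x"
    and upper: "g x \<le> B * norm x"
    and lower: "norm x \<le> B * g x"
    and D1: "1 \<le> D"
    and B_pos: "0 < B"
begin

lemma nonneg: "0 \<le> g x"
  using lower[of x] B_pos by (metis norm_ge_zero order_trans zero_le_mult_iff not_less)

lemma zero [simp]: "g 0 = 0"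
  using upper[of 0] nonneg[of 0] by simp

lemma eq_zero: "g x = 0 \<longleftrightarrow> x = 0"
  using lower[of x] by auto

lemma diff_triangle: "g (x - z) \<le> g (x - y) + g (y - z)"
  using add[of "x - y" "y - z"] by simp

lemma diff_commute_le: "g (x - y) \<le> D * g (y - x)"
  using neg[of "y - x"] by simp

lemma continuous_on_gauge: "continuous_on A g"
proof -
  have "\<bar>g x - g y\<bar> \<le> B * norm (x - y)" for x y
    using diff_triangle[of x 0 y] diff_triangle[of y 0 x] upper[of "x - y"] upper[of "y - x"]
    by (simp add: norm_minus_commute)
  then show ?thesis
    by (intro lipschitz_on_continuous_on[of B] lipschitz_onI) (use B_pos in \<open>auto simp: dist_norm\<close>)
qed

definition gball :: "'a \<Rightarrow> real \<Rightarrow> 'a set" where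
  "gball x r = {y. g (y - x) \<le> r}"

lemma mem_gball [simp]: "y \<in> gball x r \<longleftrightarrow> g (y - x) \<le> r"
  by (simp add: gball_def)

lemma gball_image:
  assumes "0 < s"
  shows "gball a s = (\<lambda>y. s *\<^sub>R y + a) ` gball 0 1"
proof -
  have "y \<in> (\<lambda>y. s *\<^sub>R y + a) ` gball 0 1" if "y \<in> gball a s" for y
  proof (rule image_eqI)
    show "y = s *\<^sub>R ((1 / s) *\<^sub>R (y - a)) + a" using assms by simp
    show "(1 / s) *\<^sub>R (y - a) \<in> gball 0 1"
      using that assms scale[of "1 / s" "y - a"]
      by (simp only: mem_gball diff_zero) (simp add: divide_le_eq)
  qed
  then show ?thesis using assms by (auto simp: scale)
qed

lemma closed_gball: "closed (gball x r)"
proof -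
  have "continuous_on UNIV (\<lambda>y. g (y - x))"
    by (rule continuous_on_compose2[OF continuous_on_gauge[of UNIV]]) (auto intro!: continuous_intros)
  then show ?thesis unfolding gball_def by (intro closed_Collect_le) (auto intro!: continuous_intros)
qed

lemma compact_gball: "compact (gball x r)"
proof -
  have "dist x y \<le> B * r" if "y \<in> gball x r" for y
  proof -
    have "B * g (y - x) \<le> B * r" using that B_pos by (simp add: mult_left_mono)
    then show ?thesis using lower[of "y - x"] by (simp add: dist_norm norm_minus_commute)
  qed
  then have "bounded (gball x r)" unfolding bounded_def by blast
  then show ?thesis using closed_gball compact_eq_bounded_closed by blast
qed

section \<open>Volumes of gauge balls and finite nets\<close>

lemma measure_gball:
  assumes "0 < s"
  shows "measure lebesgue (gball a s) = s ^ DIM('a) * measure lebesgue (gball 0 1)"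
  unfolding gball_image[OF assms] using assms measure_lebesgue_affine[of s a] by simp

lemma lmeasurable_gball: "gball x r \<in> lmeasurable"
  by (simp add: compact_gball lmeasurable_compact)

lemma measure_gball_pos: "0 < measure lebesgue (gball 0 1)"
proof -
  have "ball 0 (1 / B) \<subseteq> gball 0 1"
  proof
    fix y :: 'a assume "y \<in> ball 0 (1 / B)"
    then show "y \<in> gball 0 1" using upper[of y] B_pos by (simp add: field_simps)
  qed
  then have "\<not> negligible (gball 0 1)"
    using open_not_negligible[of "ball 0 (1 / B)"] B_pos negligible_subset by auto
  then show ?thesis
    using negligible_iff_measure0[OF lmeasurable_gball] measure_nonneg[of lebesgue "gball 0 1"]
    by (simp add: less_le)
qed

text \<open>Packing by volume: small balls around the points of \<open>A\<close> are disjoint and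
  lie in \<open>gball 0 2\<close>. As \<open>g\<close> is asymmetric, separation means that at least
  one of the two differences is large.\<close>

lemma card_separated_le:
  assumes "finite A" "A \<subseteq> gball 0 1"
    and sep: "\<And>a b. a \<in> A \<Longrightarrow> b \<in> A \<Longrightarrow> a \<noteq> b \<Longrightarrow> 1 / 4 < g (a - b) \<or> 1 / 4 < g (b - a)"
  shows "real (card A) \<le> (16 * D) ^ DIM('a)"
proof -
  \<comment> \<open>A common point \<open>w\<close> of two small balls gives \<open>g (a - b) \<le>
    g (a - w) + g (w - b) \<le> D * s + s \<le> 1 / 4\<close>. The ratio \<open>2 / s\<close> of the
    radii is the base \<open>16 * D\<close>.\<close>
  define s where "s = 1 / (8 * D)"
  have s: "0 < s" "D * s \<le> 1 / 8" "s \<le> 1 / 8" using D1 by (auto simp: s_def)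
  let ?v = "measure lebesgue (gball 0 1)"
  have near: "g (a - b) \<le> 1 / 4" if "w \<in> gball a s" "w \<in> gball b s" for a b w
  proof -
    have "D * g (w - a) \<le> D * s" using that D1 by (intro mult_left_mono) auto
    then show ?thesis
      using that diff_triangle[of a b w] diff_commute_le[of a w] s by simp
  qed
  have disj: "disjoint_family_on (\<lambda>a. gball a s) A"
    unfolding disjoint_family_on_def
  proof (intro ballI impI equals0I)
    fix a b w assume "a \<in> A" "b \<in> A" "a \<noteq> b" and w: "w \<in> gball a s \<inter> gball b s"
    then show False using sep[of a b] near[of w a b] near[of w b a] by auto
  qed
  have "real (card A) * (s ^ DIM('a) * ?v) = (\<Sum>a\<in>A. measure lebesgue (gball a s))"
    by (simp add: measure_gball[OF s(1)])
  also have "\<dots> = measure lebesgue (\<Union>a\<in>A. gball a s)"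
  proof (rule measure_finite_Union[symmetric, OF assms(1) _ disj])
    show "(\<lambda>a. gball a s) ` A \<subseteq> sets lebesgue"
      using fmeasurableD[OF lmeasurable_gball] by blast
    show "emeasure lebesgue (gball a s) \<noteq> \<infinity>" for a
      using fmeasurableD2[OF lmeasurable_gball, of a s] by simp
  qed
  also have "\<dots> \<le> measure lebesgue (gball 0 2)"
  proof (rule measure_mono_fmeasurable)
    have "g w \<le> 2" if "a \<in> A" "w \<in> gball a s" for a w
    proof -
      have "g a \<le> 1" using that assms by auto
      then show ?thesis using that add[of a "w - a"] s by simp
    qed
    then show "(\<Union>a\<in>A. gball a s) \<subseteq> gball 0 2" by auto
    show "(\<Union>a\<in>A. gball a s) \<in> sets lebesgue"
      using assms(1) fmeasurableD[OF lmeasurable_gball] by (intro sets.finite_UN) auto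
  qed (rule lmeasurable_gball)
  also have "\<dots> = 2 ^ DIM('a) * ?v" by (simp add: measure_gball[of 2])
  finally have "real (card A) * s ^ DIM('a) \<le> 2 ^ DIM('a)"
    using measure_gball_pos by (simp add: mult.assoc[symmetric])
  then have "real (card A) \<le> (2 / s) ^ DIM('a)" using s by (simp add: power_divide pos_le_divide_eq)
  then show ?thesis by (simp add: s_def)
qed

text \<open>A separated set of largest cardinality is a net, since a point far from all its members
  could be added to it. The volume bound ensures that a largest one exists.\<close>

lemma finite_net:
  obtains A where "finite A" "real (card A) \<le> (16 * D) ^ DIM('a)"
    "\<And>u. g u \<le> 1 \<Longrightarrow> \<exists>a\<in>A. g (u - a) \<le> 1 / 4 \<and> g (a - u) \<le> 1 / 4"
proof -
  define P where "P A \<longleftrightarrow> finite A \<and> A \<subseteq> gball 0 1 \<and>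
    (\<forall>a\<in>A. \<forall>b\<in>A. a \<noteq> b \<longrightarrow> 1 / 4 < g (a - b) \<or> 1 / 4 < g (b - a))" for A
  have bound: "real (card A) \<le> (16 * D) ^ DIM('a)" if "P A" for A
    using that card_separated_le[of A] unfolding P_def by blast
  then have "\<forall>A. P A \<longrightarrow> card A \<le> nat \<lfloor>(16 * D) ^ DIM('a)\<rfloor>"
    by (simp add: le_nat_floor)
  moreover have "P {}" by (simp add: P_def)
  ultimately obtain A where A: "P A" "\<And>A'. P A' \<Longrightarrow> card A' \<le> card A"
    using ex_has_greatest_nat[of P "{}" card] by (metis le_imp_less_Suc)
  have "\<exists>a\<in>A. g (u - a) \<le> 1 / 4 \<and> g (a - u) \<le> 1 / 4" if u: "g u \<le> 1" for u
  proof (rule ccontr)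
    assume far: "\<not> ?thesis"
    then have "u \<notin> A" by force
    moreover have "P (insert u A)" using A(1) u far unfolding P_def by force
    ultimately show False using A(2)[of "insert u A"] A(1) by (simp add: P_def)
  qed
  then show thesis using that A(1) bound unfolding P_def by blast
qed

end

subsection \<open>The gauge of a convex body at its Helly centre\<close>

text \<open>For one \<open>y\<close> the admissible centres form a compact convex set
  \<open>A y\<close>. Helly's theorem makes finitely many of these sets meet, and compactness passes
  to all \<open>y\<close> in \<open>C\<close>.\<close>

lemma convex_compact_centre:
  fixes C :: "'a::euclidean_space set"
  assumes "convex C" "compact C" "C \<noteq> {}"
  obtains p where "p \<in> C" "\<And>y. y \<in> C \<Longrightarrow> p + (1 / DIM('a)) *\<^sub>R (p - y) \<in> C"
proof -
  define d where "d = real DIM('a)"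
  have d: "d > 0" by (simp add: d_def)
  define A where "A y = C \<inter> (\<lambda>p. p + (1 / d) *\<^sub>R (p - y)) -` C" for y
  \<comment> \<open>The centroid of at most \<open>d + 1\<close> points \<open>Y\<close> lies in all \<open>A y\<close>, so Helly's theorem applies.\<close>
  have few: "(\<Inter>y\<in>Y. A y) \<noteq> {}" if Y: "finite Y" "Y \<subseteq> C" "Y \<noteq> {}" "card Y \<le> DIM('a) + 1" for Y
  proof -
    define m where "m = real (card Y)"
    have m: "m > 0" "m \<le> d + 1" using Y by (auto simp: m_def d_def card_gt_0_iff)
    define q where "q = (\<Sum>x\<in>Y. (1 / m) *\<^sub>R x)"
    have "q \<in> C"
      unfolding q_def by (rule convex_sum) (use Y m assms in \<open>auto simp: m_def\<close>)
    moreover have "q + (1 / d) *\<^sub>R (q - y) \<in> C" if y: "y \<in> Y" for y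
    proof -
      \<comment> \<open>These are the weights of the reflected point over \<open>Y\<close>. The
        weight at \<open>y\<close> is nonnegative exactly because \<open>m \<le> d + 1\<close>,
        which is the Helly number.\<close>
      define a where "a x = (1 + 1 / d) / m - (if x = y then 1 / d else 0)" for x
      have "q + (1 / d) *\<^sub>R (q - y) = (\<Sum>x\<in>Y. a x *\<^sub>R x)"
      proof -
        have "(\<Sum>x\<in>Y. a x *\<^sub>R x)
            = (\<Sum>x\<in>Y. (1 + 1 / d) *\<^sub>R ((1 / m) *\<^sub>R x) - (if x = y then (1 / d) *\<^sub>R x else 0))"
          by (intro sum.cong) (auto simp: a_def scaleR_left_diff_distrib)
        also have "\<dots> = (1 + 1 / d) *\<^sub>R q - (1 / d) *\<^sub>R y"
          using y Y by (simp only: sum_subtractf scaleR_sum_right[symmetric] q_def)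
            (simp add: sum.delta)
        finally show ?thesis by (simp add: algebra_simps)
      qed
      moreover have "(\<Sum>x\<in>Y. a x *\<^sub>R x) \<in> C"
      proof (rule convex_sum)
        have "sum a Y = m * ((1 + 1 / d) / m) - 1 / d"
          using y Y by (simp add: a_def sum_subtractf m_def)
        then show "sum a Y = 1" using m by simp
        have "1 / d \<le> (1 + 1 / d) / m" using m d by (simp add: field_simps)
        then show "a x \<ge> 0" for x using d m by (auto simp: a_def)
      qed (use Y assms in auto)
      ultimately show ?thesis by simp
    qed
    ultimately have "q \<in> (\<Inter>y\<in>Y. A y)" using Y by (auto simp: A_def)
    then show ?thesis by blast
  qed
  have clo: "closed (A y)" for y
    unfolding A_def using assms(2)
    by (intro closed_Int continuous_closed_vimage compact_imp_closed) (auto intro!: continuous_intros)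
  have conv: "convex (A y)" for y
  proof -
    have "convex ((\<lambda>p. p + (1 / d) *\<^sub>R (p - y)) -` C)"
    proof (rule convexI)
      fix p q u v assume pq: "p \<in> (\<lambda>p. p + (1 / d) *\<^sub>R (p - y)) -` C"
        "q \<in> (\<lambda>p. p + (1 / d) *\<^sub>R (p - y)) -` C" and uv: "0 \<le> u" "0 \<le> v" "u + v = (1::real)"
      have v: "v = 1 - u" using uv by simp
      have "u *\<^sub>R p + v *\<^sub>R q + (1 / d) *\<^sub>R (u *\<^sub>R p + v *\<^sub>R q - y)
          = u *\<^sub>R (p + (1 / d) *\<^sub>R (p - y)) + v *\<^sub>R (q + (1 / d) *\<^sub>R (q - y))"
        unfolding v by (simp add: algebra_simps flip: scaleR_add_left add_divide_distrib)
      also have "\<dots> \<in> C" using pq uv assms(1) by (intro convexD) auto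
      finally show "u *\<^sub>R p + v *\<^sub>R q \<in> (\<lambda>p. p + (1 / d) *\<^sub>R (p - y)) -` C" by simp
    qed
    then show ?thesis unfolding A_def using assms by (simp add: convex_Int)
  qed
  have "C \<inter> (\<Inter>y\<in>C. A y) \<noteq> {}"
  proof (rule compact_imp_fip_image)
    fix Y assume Y: "finite Y" "Y \<subseteq> C"
    show "C \<inter> (\<Inter>y\<in>Y. A y) \<noteq> {}"
    proof (cases "Y = {}")
      case False
      \<comment> \<open>Helly's theorem counts distinct sets, whereas \<open>few\<close> counts
        points; choosing \<open>Z\<close> with \<open>A\<close> injective on it makes the two counts
        agree.\<close>
      have sub: "\<Inter>T \<noteq> {}" if T: "T \<subseteq> A ` Y" "card T \<le> DIM('a) + 1" "T \<noteq> {}" for T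
      proof -
        obtain Z where Z: "Z \<subseteq> Y" "T = A ` Z" "inj_on A Z"
          using T(1) by (metis subset_image_inj)
        then have "card Z \<le> DIM('a) + 1" using T by (simp add: card_image)
        then show ?thesis using few[of Z] Z T Y by (auto intro: finite_subset)
      qed
      \<comment> \<open>Helly's theorem requires at least \<open>d + 1\<close> sets; smaller
        families are covered by \<open>sub\<close> directly.\<close>
      have "\<Inter>(A ` Y) \<noteq> {}"
      proof (cases "card (A ` Y) \<le> DIM('a) + 1")
        case True
        then show ?thesis using sub False by blast
      next
        case 2: False
        show ?thesis
        proof (rule Helly)
          fix T assume "T \<subseteq> A ` Y" "card T = DIM('a) + 1"
          then show "\<Inter>T \<noteq> {}" by (intro sub) auto
        qed (use 2 conv in auto)
      qed
      then show ?thesis using False unfolding A_def by blast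
    qed (use assms in auto)
  qed (use assms clo in auto)
  then obtain p where "p \<in> C" and p: "\<And>y. y \<in> C \<Longrightarrow> p \<in> A y" by blast
  then show thesis using that[of p] by (simp add: A_def d_def)
qed

text \<open>\<open>g\<close> is the Minkowski functional of \<open>K\<close>: convexity yields the
  triangle inequality, \<open>sym\<close> the bound on \<open>g (- x)\<close>, and balls inside and
  around \<open>K\<close> the comparison with the norm.\<close>

lemma gauge_exists:
  fixes K :: "'a::euclidean_space set"
  assumes conv: "convex K" and comp: "compact K" and int: "0 \<in> interior K"
    and D: "1 \<le> D" and sym: "\<And>y. y \<in> K \<Longrightarrow> - ((1 / D) *\<^sub>R y) \<in> K"
  obtains g B where "asymmetric_norm g D B" "\<And>x t. 0 < t \<Longrightarrow> g x \<le> t \<longleftrightarrow> (1 / t) *\<^sub>R x \<in> K"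
proof -
  define T where "T x = {t. 0 < t \<and> (1 / t) *\<^sub>R x \<in> K}" for x
  define g where "g x = Inf (T x)" for x
  obtain e where e: "0 < e" "cball 0 e \<subseteq> K" using int mem_interior_cball by blast
  obtain M where M: "0 < M" "\<And>y. y \<in> K \<Longrightarrow> norm y \<le> M"
    using compact_imp_bounded[OF comp] bounded_pos by blast
  have K0: "0 \<in> K" using int interior_subset by blast
  have T_norm: "norm x / e \<in> T x" if "x \<noteq> 0" for x
    using that e by (auto simp: T_def subset_iff)
  have T_0: "1 \<in> T 0" by (simp add: T_def K0)
  have T_ne: "T x \<noteq> {}" for x using T_norm T_0 by (cases "x = 0") auto
  have T_bdd: "bdd_below (T x)" for x by (rule bdd_belowI[of _ 0]) (auto simp: T_def)
  have T_up: "s \<in> T x" if "t \<in> T x" "t \<le> s" for s t x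
  proof -
    have t: "0 < t" "0 < s" using that by (auto simp: T_def)
    \<comment> \<open>Shrinking towards \<open>0\<close> stays in \<open>K\<close>, so
      \<open>T x\<close> is closed upwards.\<close>
    have "(t / s) *\<^sub>R ((1 / t) *\<^sub>R x) + (1 - t / s) *\<^sub>R 0 \<in> K"
      using that t K0 by (intro convexD[OF conv]) (auto simp: T_def)
    then show ?thesis using t by (simp add: T_def)
  qed
  have above: "s \<in> T x" if "g x < s" for s x
    using that T_up cInf_less_iff[OF T_ne T_bdd, of x s] by (auto simp: g_def intro: less_imp_le)
  have mem: "g x \<le> t \<longleftrightarrow> (1 / t) *\<^sub>R x \<in> K" if t: "0 < t" for x t
  proof
    assume "g x \<le> t"
    \<comment> \<open>Membership is known only for \<open>s > t\<close>; closedness of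
      \<open>K\<close> carries it over to the limit \<open>s = t\<close>.\<close>
    then have ev: "eventually (\<lambda>s. (1 / s) *\<^sub>R x \<in> K) (at_right t)"
      using above[of x] by (auto simp: eventually_at_filter T_def intro!: always_eventually)
    have "((\<lambda>s. (1 / s) *\<^sub>R x) \<longlongrightarrow> (1 / t) *\<^sub>R x) (at_right t)"
      using t by (intro tendsto_intros) auto
    then show "(1 / t) *\<^sub>R x \<in> K"
      by (rule Lim_in_closed_set[OF compact_imp_closed[OF comp] ev, rotated]) simp
  next
    assume "(1 / t) *\<^sub>R x \<in> K"
    then show "g x \<le> t" using t unfolding g_def by (intro cInf_lower T_bdd) (auto simp: T_def)
  qed
  have g_nonneg: "0 \<le> g x" for x
    unfolding g_def by (rule cInf_greatest[OF T_ne]) (auto simp: T_def)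
  have g_0: "g 0 = 0"
  proof (rule antisym)
    show "g 0 \<le> 0" by (rule dense_ge) (simp add: mem K0)
  qed (rule g_nonneg)
  have "asymmetric_norm g D (max (1 / e) M)"
  proof
    fix x y
    have *: "g (x + y) \<le> a + b" if "g x < a" "g y < b" for a b
    proof -
      have ab: "0 < a" "0 < b" using that g_nonneg[of x] g_nonneg[of y] by linarith+
      \<comment> \<open>The point \<open>x + y\<close> divided by \<open>a + b\<close> is a convex
        combination of \<open>x / a\<close> and \<open>y / b\<close>.\<close>
      have "(a / (a + b)) *\<^sub>R ((1 / a) *\<^sub>R x) + (b / (a + b)) *\<^sub>R ((1 / b) *\<^sub>R y) \<in> K"
        using that ab mem[of a x] mem[of b y]
        by (intro convexD[OF conv]) (auto simp flip: add_divide_distrib)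
      then show ?thesis using ab mem[of "a + b" "x + y"] by (simp add: scaleR_add_right)
    qed
    show "g (x + y) \<le> g x + g y"
    proof (rule field_le_epsilon)
      fix \<epsilon> :: real assume "0 < \<epsilon>"
      then show "g (x + y) \<le> g x + g y + \<epsilon>" using *[of "g x + \<epsilon> / 2" "g y + \<epsilon> / 2"] by simp
    qed
  next
    fix t x assume t: "(0::real) \<le> t"
    show "g (t *\<^sub>R x) = t * g x"
    proof (cases "t = 0")
      case False
      have iff: "g (t *\<^sub>R x) / t \<le> s \<longleftrightarrow> g x \<le> s" if "0 < s" for s
        using t False that mem[of "s * t" "t *\<^sub>R x"] mem[of s x] by (simp add: divide_le_eq)
      have "g (t *\<^sub>R x) / t = g x"
      proof (rule antisym; rule dense_ge)
        fix s assume "g x < s"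
        then show "g (t *\<^sub>R x) / t \<le> s" using iff[of s] g_nonneg[of x] by simp
      next
        fix s assume "g (t *\<^sub>R x) / t < s"
        moreover have "0 \<le> g (t *\<^sub>R x) / t" using t g_nonneg[of "t *\<^sub>R x"] by simp
        ultimately show "g x \<le> s" using iff[of s] by simp
      qed
      then show ?thesis using False by (simp add: field_simps)
    qed (simp add: g_0)
  next
    fix x
    have "g (- x) / D \<le> g x"
    proof (rule dense_ge)
      fix s assume s: "g x < s"
      then have s0: "0 < s" using g_nonneg[of x] by simp
      then have "- ((1 / D) *\<^sub>R ((1 / s) *\<^sub>R x)) \<in> K" using sym[of "(1 / s) *\<^sub>R x"] mem[of s x] s by simp
      then have "g (- x) \<le> D * s" using mem[of "D * s" "- x"] s0 D by simp
      then show "g (- x) / D \<le> s" using D by (simp add: divide_le_eq mult.commute)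
    qed
    then show "g (- x) \<le> D * g x" using D by (simp add: divide_le_eq mult.commute)
  next
    fix x
    have "g x \<le> norm x / e"
    proof (cases "x = 0")
      case False
      then show ?thesis using T_norm[OF False] mem[of "norm x / e" x] e by (auto simp: T_def)
    qed (simp add: g_0)
    also have "\<dots> \<le> max (1 / e) M * norm x"
      using mult_right_mono[of "1 / e" "max (1 / e) M" "norm x"] by simp
    finally show "g x \<le> max (1 / e) M * norm x" .
  next
    fix x
    have "norm x / M \<le> g x"
    proof (rule dense_ge)
      fix s assume s: "g x < s"
      then have s0: "0 < s" using g_nonneg[of x] by simp
      then have "norm ((1 / s) *\<^sub>R x) \<le> M" using mem[of s x] s by (intro M(2)) simp
      then show "norm x / M \<le> s" using s0 M by (simp add: divide_le_eq mult.commute)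
    qed
    then have "norm x \<le> M * g x" using M by (simp add: divide_le_eq mult.commute)
    also have "\<dots> \<le> max (1 / e) M * g x" using g_nonneg[of x] by (intro mult_right_mono) auto
    finally show "norm x \<le> max (1 / e) M * g x" .
  next
    show "0 < max (1 / e) M" using M by simp
  qed (rule D)
  then show thesis using that mem by blast
qed

text \<open>Taking the gauge at the Helly centre \<open>p\<close> gives asymmetry at most the
  dimension. Since a homothet scales about the origin, the shift \<open>x - r *\<^sub>R p\<close> is
  what moves \<open>p\<close> to \<open>x\<close>.\<close>

lemma convex_body_gauge:
  fixes C :: "'a::euclidean_space set"
  assumes "convex_body C"
  obtains g B p where "asymmetric_norm g (real DIM('a)) B"
    "\<And>x r. 0 < r \<Longrightarrow> {y. g (y - x) \<le> r} = homothet C r (x - r *\<^sub>R p)"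
proof -
  have C: "convex C" "compact C" "interior C \<noteq> {}" using assms by (auto simp: convex_body_def)
  define d where "d = real DIM('a)"
  have d: "1 \<le> d" by (simp add: d_def Suc_leI)
  have "C \<noteq> {}" using C interior_subset by auto
  then obtain p where p: "p \<in> C" "\<And>y. y \<in> C \<Longrightarrow> p + (1 / d) *\<^sub>R (p - y) \<in> C"
    using convex_compact_centre[of C] C unfolding d_def by metis
  obtain y where y: "y \<in> interior C" using C by auto
  then have q: "p + (1 / d) *\<^sub>R (p - y) \<in> C" using p interior_subset by blast
  \<comment> \<open>\<open>p\<close> lies strictly between the interior point \<open>y\<close> and
    its scaled reflection in \<open>C\<close>, hence is interior. The weight
    \<open>1 / (d + 1)\<close> is the position of \<open>p\<close> on that segment.\<close>
  have "p + (1 / d) *\<^sub>R (p - y) - (1 / (d + 1)) *\<^sub>R (p + (1 / d) *\<^sub>R (p - y) - y) \<in> interior C"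
    using d by (intro mem_interior_convex_shrink C y q) auto
  moreover have "p + (1 / d) *\<^sub>R (p - y) - (1 / (d + 1)) *\<^sub>R (p + (1 / d) *\<^sub>R (p - y) - y) = p"
  proof -
    have "p + (1 / d) *\<^sub>R (p - y) - y = ((d + 1) / d) *\<^sub>R (p - y)"
      using d by (simp add: add_divide_distrib scaleR_add_left)
    then show ?thesis using d by simp
  qed
  ultimately have pint: "p \<in> interior C" by simp
  define K where "K = (\<lambda>y. y - p) ` C"
  have K: "v \<in> K \<longleftrightarrow> v + p \<in> C" for v unfolding K_def by force
  obtain g B where g: "asymmetric_norm g d B"
      "\<And>x t. 0 < t \<Longrightarrow> g x \<le> t \<longleftrightarrow> (1 / t) *\<^sub>R x \<in> K"
  proof (rule gauge_exists[of K d])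
    show "convex K" unfolding K_def using C by (simp add: convex_translation_subtract_eq)
    show "compact K" unfolding K_def using C by (simp add: compact_translation_subtract)
    show "0 \<in> interior K" unfolding K_def using pint by (simp add: interior_translation_subtract)
    show "- ((1 / d) *\<^sub>R y) \<in> K" if "y \<in> K" for y
      using p(2)[of "y + p"] that by (simp add: K algebra_simps)
  qed (use d in auto)
  have "{y. g (y - x) \<le> r} = homothet C r (x - r *\<^sub>R p)" if r: "0 < r" for x r
  proof (intro set_eqI iffI)
    fix y assume "y \<in> {y. g (y - x) \<le> r}"
    then have "(1 / r) *\<^sub>R (y - x) + p \<in> C" using g(2)[OF r] by (simp add: K)
    moreover have "y = r *\<^sub>R ((1 / r) *\<^sub>R (y - x) + p) + (x - r *\<^sub>R p)"
      using r by (simp add: scaleR_add_right)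
    ultimately show "y \<in> homothet C r (x - r *\<^sub>R p)" unfolding homothet_def by blast
  next
    fix y assume "y \<in> homothet C r (x - r *\<^sub>R p)"
    then obtain v where v: "v \<in> C" "y = r *\<^sub>R v + (x - r *\<^sub>R p)" unfolding homothet_def by blast
    have "(1 / r) *\<^sub>R (y - x) + p = v" unfolding v(2) using r by (simp add: algebra_simps)
    then show "y \<in> {y. g (y - x) \<le> r}" using g(2)[OF r] v by (simp add: K)
  qed
  then show thesis using that g unfolding d_def by blast
qed

subsection \<open>A Besicovitch covering lemma\<close>

text \<open>Along the increasing order of \<open>J\<close> there are \<open>card J - 1\<close> gaps
  of at least \<open>s\<close> each. This later counts the centres whose directions share a
  cell.\<close>

lemma card_spread_le:
  fixes f :: "'i::linorder \<Rightarrow> real"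
  assumes "finite J" "J \<noteq> {}"
    and "\<And>i. i \<in> J \<Longrightarrow> 0 \<le> f i"
    and "\<And>i j. i \<in> J \<Longrightarrow> j \<in> J \<Longrightarrow> i < j \<Longrightarrow> f i + s \<le> f j"
  shows "(real (card J) - 1) * s \<le> f (Max J)"
  using assms
proof (induction rule: finite_linorder_max_induct)
  case (insert b J)
  have "Max (insert b J) = b"
    using insert.hyps by (intro Max_eqI) (auto intro: less_imp_le)
  moreover have "b \<notin> J" using insert.hyps by auto
  moreover have "real (card J) * s \<le> f b"
  proof (cases "J = {}")
    case False
    have "(real (card J) - 1) * s \<le> f (Max J)"
      using insert False by (intro insert.IH) auto
    moreover have "f (Max J) + s \<le> f b"
      using insert Max_in[OF insert.hyps(1) False] by (intro insert.prems) auto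
    ultimately show ?thesis by (simp add: algebra_simps)
  qed (use insert in auto)
  ultimately show ?case using insert.hyps by simp
qed simp

text \<open>Double counting: the sum of the measures is the integral of the number of sets that
  contain a point.\<close>

lemma (in finite_measure) sum_measure_le:
  assumes "finite I" "\<And>i. i \<in> I \<Longrightarrow> A i \<in> sets M"
    and overlap: "\<And>w. w \<in> space M \<Longrightarrow> real (card {i \<in> I. w \<in> A i}) \<le> m"
  shows "(\<Sum>i\<in>I. measure M (A i)) \<le> m * measure M (space M)"
proof -
  have int: "integrable M (indicator (A i) :: _ \<Rightarrow> real)" if "i \<in> I" for i
    using assms(2)[OF that] by (simp add: emeasure_eq_measure)
  have "(\<Sum>i\<in>I. measure M (A i)) = (\<integral>w. (\<Sum>i\<in>I. indicator (A i) w) \<partial>M)"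
    using assms(2) int by (subst Bochner_Integration.integral_sum) auto
  also have "\<dots> \<le> (\<integral>w. m \<partial>M)"
  proof (rule integral_mono)
    fix w assume "w \<in> space M"
    moreover have "(\<Sum>i\<in>I. indicator (A i) w :: real) = real (card {i \<in> I. w \<in> A i})"
      using assms(1) by (simp add: indicator_def sum.If_cases Int_def)
    ultimately show "(\<Sum>i\<in>I. indicator (A i) w) \<le> m" using overlap by simp
  qed (use int in auto)
  finally show ?thesis by (simp add: mult.commute)
qed

context asymmetric_norm
begin

text \<open>With \<open>p = z - x\<^sub>i\<close> and \<open>q = z - x\<^sub>j\<close>, the
  assumption \<open>r < g (p - q)\<close> says that \<open>x\<^sub>j\<close> is outside the ball
  around \<open>x\<^sub>i\<close>. First, \<open>g q \<le> g p\<close> would force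
  \<open>g (p - q) \<le> r\<close>. Then splitting \<open>p - q\<close> along \<open>u - v\<close>
  and \<open>- v\<close> gives \<open>r < r / 2 + D * (g q - g p)\<close>.\<close>

lemma gap_of_close_directions:
  assumes p: "p = g p *\<^sub>R u" "q = g q *\<^sub>R v" and uv: "g u \<le> 1" "g v \<le> 1" "g (u - v) \<le> 1 / 2"
    and r: "g p \<le> r" "r < g (p - q)"
  shows "g p + r / (2 * D) \<le> g q"
proof -
  have "g p < g q"
  proof (rule ccontr)
    assume "\<not> g p < g q"
    then have le: "g q \<le> g p" by simp
    have "p - q = (g p - g q) *\<^sub>R u + g q *\<^sub>R (u - v)"
      using p by (simp add: algebra_simps)
    then have "g (p - q) \<le> (g p - g q) * g u + g q * g (u - v)"
      using add[of "(g p - g q) *\<^sub>R u" "g q *\<^sub>R (u - v)"] le nonneg[of q] by (simp add: scale)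
    also have "\<dots> \<le> (g p - g q) * 1 + g q * (1 / 2)"
      using le nonneg[of q] uv by (intro add_mono mult_left_mono) auto
    also have "\<dots> \<le> r" using nonneg[of q] r by simp
    finally show False using r by simp
  qed
  have "p - q = g p *\<^sub>R (u - v) + (g q - g p) *\<^sub>R (- v)"
    using p by (simp add: algebra_simps)
  then have "g (p - q) \<le> g p * g (u - v) + (g q - g p) * g (- v)"
    using add[of "g p *\<^sub>R (u - v)" "(g q - g p) *\<^sub>R (- v)"] \<open>g p < g q\<close> nonneg[of p]
      scale[of "g p" "u - v"] scale[of "g q - g p" "- v"] by simp
  also have "\<dots> \<le> g p * (1 / 2) + (g q - g p) * D"
  proof -
    have "D * g v \<le> D * 1" using uv D1 by (intro mult_left_mono) auto
    then have "g (- v) \<le> D" using neg[of v] by simp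
    then show ?thesis using \<open>g p < g q\<close> nonneg[of p] uv by (intro add_mono mult_left_mono) auto
  qed
  finally have "r \<le> 2 * D * (g q - g p)" using r by (simp add: algebra_simps)
  then have "r / (2 * D) \<le> g q - g p" using D1 by (simp add: divide_le_eq mult.commute)
  then show ?thesis by simp
qed

lemma besicovitch_multiplicity:
  fixes x :: "'i::linorder \<Rightarrow> 'a"
  assumes "finite I"
    and pos: "\<And>i. i \<in> I \<Longrightarrow> 0 < r i"
    and outside: "\<And>i j. i \<in> I \<Longrightarrow> j \<in> I \<Longrightarrow> i < j \<Longrightarrow> x j \<notin> gball (x i) (r i)"
    and decr: "\<And>i j. i \<in> I \<Longrightarrow> j \<in> I \<Longrightarrow> i < j \<Longrightarrow> r j \<le> 2 * r i"
    and common: "\<And>i. i \<in> I \<Longrightarrow> z \<in> gball (x i) (r i)"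
  shows "real (card I) \<le> (16 * D) ^ DIM('a) * (4 * D + 1)"
proof -
  obtain A where A: "finite A" "real (card A) \<le> (16 * D) ^ DIM('a)"
    "\<And>u. g u \<le> 1 \<Longrightarrow> \<exists>a\<in>A. g (u - a) \<le> 1 / 4 \<and> g (a - u) \<le> 1 / 4"
    using finite_net by blast
  define p where "p i = z - x i" for i
  \<comment> \<open>If \<open>p i = 0\<close> then \<open>u i = 0\<close>, so both facts below hold
    without a case distinction.\<close>
  define u where "u i = (1 / g (p i)) *\<^sub>R p i" for i
  have u1: "g (u i) \<le> 1" for i
    using nonneg[of "p i"] by (simp add: u_def scale)
  have pu: "p i = g (p i) *\<^sub>R u i" for i
    by (simp add: u_def eq_zero)
  obtain a where a: "\<And>i. a i \<in> A" "\<And>i. g (u i - a i) \<le> 1 / 4" "\<And>i. g (a i - u i) \<le> 1 / 4"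
    using A(3)[OF u1] by metis
  have class_le: "real (card {i \<in> I. a i = b}) \<le> 4 * D + 1" for b
  proof (cases "{i \<in> I. a i = b} = {}")
    case False
    define J where "J = {i \<in> I. a i = b}"
    have J: "finite J" "J \<noteq> {}" "\<And>i. i \<in> J \<Longrightarrow> i \<in> I" using False assms(1) by (auto simp: J_def)
    define l where "l = Max J"
    have l: "l \<in> J" "\<And>i. i \<in> J \<Longrightarrow> i \<le> l" using J by (auto simp: l_def)
    \<comment> \<open>The gap after index \<open>i\<close> is \<open>r i / (2 * D)\<close>. As
      \<open>l\<close> is the last index, \<open>r l \<le> 2 * r i\<close> turns this into a gap
      \<open>s\<close> common to all of \<open>J\<close>.\<close>
    define s where "s = r l / (4 * D)"
    have gap: "g (p i) + s \<le> g (p j)" if "i \<in> J" "j \<in> J" "i < j" for i j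
    proof -
      \<comment> \<open>The path goes through the net point \<open>b\<close>, so closeness to
        \<open>b\<close> is needed in both orders.\<close>
      have "g (u i - u j) \<le> 1 / 2"
        using diff_triangle[of "u i" "u j" b] a(2)[of i] a(3)[of j] that by (auto simp: J_def)
      moreover have "g (p i) \<le> r i" "r i < g (p i - p j)"
        using common[of i] outside[of i j] that J(3) by (auto simp: p_def)
      ultimately have "g (p i) + r i / (2 * D) \<le> g (p j)"
        using gap_of_close_directions[OF pu[of i] pu[of j] u1 u1] by blast
      moreover have "r l \<le> 2 * r i"
        using decr[of i l] l that J(3) by fastforce
      then have "s \<le> r i / (2 * D)" using D1 by (simp add: s_def field_simps)
      ultimately show ?thesis by simp
    qed
    have "(real (card J) - 1) * s \<le> g (p l)"
      unfolding l_def using J gap nonneg by (intro card_spread_le) auto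
    also have "\<dots> \<le> r l" using common[of l] l J(3) by (simp add: p_def)
    finally have "(real (card J) - 1) * r l \<le> 4 * D * r l"
      using D1 by (simp add: s_def field_simps)
    then have "real (card J) - 1 \<le> 4 * D"
      by (rule mult_right_le_imp_le) (use pos l J(3) in blast)
    then show ?thesis by (simp add: J_def)
  next
    case True
    then have "card {i \<in> I. a i = b} = 0" by (simp only: card.empty)
    then show ?thesis using D1 by simp
  qed
  have "I = (\<Union>b\<in>A. {i \<in> I. a i = b})" using a(1) by auto
  then have "card I \<le> (\<Sum>b\<in>A. card {i \<in> I. a i = b})"
    using card_UN_le[OF A(1), of "\<lambda>b. {i \<in> I. a i = b}"] by simp
  then have "real (card I) \<le> (\<Sum>b\<in>A. real (card {i \<in> I. a i = b}))"
    by (metis of_nat_le_iff of_nat_sum)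
  also have "\<dots> \<le> real (card A) * (4 * D + 1)"
    using sum_mono[of A "\<lambda>b. real (card {i \<in> I. a i = b})" "\<lambda>_. 4 * D + 1"] class_le by simp
  also have "\<dots> \<le> (16 * D) ^ DIM('a) * (4 * D + 1)"
    using A D1 by (intro mult_right_mono) auto
  finally show ?thesis .
qed

text \<open>An arbitrary finite measure \<open>N\<close> serves both counting measure on
  \<open>S\<close> and \<open>\<mu>\<close>; the intersection with \<open>space N\<close>
  accommodates the former. Each chosen ball has mass at least \<open>\<kappa>\<close> and the
  overlap is bounded, which limits the number of choices.\<close>

lemma besicovitch_cover:
  assumes "finite_measure N" and \<kappa>: "0 < \<kappa>"
    and r: "\<And>x. x \<in> P \<Longrightarrow> 0 < r x" "\<And>x. x \<in> P \<Longrightarrow> r x \<le> R"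
    and meas: "\<And>x. x \<in> P \<Longrightarrow> gball x (r x) \<inter> space N \<in> sets N"
    and mass: "\<And>x. x \<in> P \<Longrightarrow> \<kappa> \<le> measure N (gball x (r x) \<inter> space N)"
  obtains F where "finite F" "F \<subseteq> P" "P \<subseteq> (\<Union>x\<in>F. gball x (r x))"
    "real (card F) * \<kappa> \<le> (16 * D) ^ DIM('a) * (4 * D + 1) * measure N (space N)"
proof -
  interpret finite_measure N by fact
  define m where "m = (16 * D) ^ DIM('a) * (4 * D + 1)"
  \<comment> \<open>This describes finite runs of the greedy choice. The last conjunct, that no
    uncovered point has more than twice the radius of a chosen one, is the invariant that allows a
    run to be extended.\<close>
  define good where "good n x \<longleftrightarrow> (\<forall>i<n. x i \<in> P) \<and>
    (\<forall>j<n. \<forall>i<j. x j \<notin> gball (x i) (r (x i)) \<and> r (x j) \<le> 2 * r (x i)) \<and>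
    (\<forall>y\<in>P. (\<forall>i<n. y \<notin> gball (x i) (r (x i))) \<longrightarrow> (\<forall>i<n. r y \<le> 2 * r (x i)))"
    for n :: nat and x
  have bound: "real n * \<kappa> \<le> m * measure N (space N)" if "good n x" for n x
  proof -
    have P: "x i \<in> P" if "i < n" for i using \<open>good n x\<close> that by (simp add: good_def)
    have "real n * \<kappa> = (\<Sum>i<n. \<kappa>)" by simp
    also have "\<dots> \<le> (\<Sum>i<n. measure N (gball (x i) (r (x i)) \<inter> space N))"
      using P by (intro sum_mono mass) auto
    also have "\<dots> \<le> m * measure N (space N)"
    proof (rule sum_measure_le)
      fix w assume "w \<in> space N"
      show "real (card {i \<in> {..<n}. w \<in> gball (x i) (r (x i)) \<inter> space N}) \<le> m"
        unfolding m_def by (rule besicovitch_multiplicity[where r = "\<lambda>i. r (x i)" and x = x and z = w])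
          (use \<open>good n x\<close> P r(1) in \<open>auto simp: good_def simp del: mem_gball\<close>)
    qed (use P meas in auto)
    finally show ?thesis .
  qed
  \<comment> \<open>\<open>bound\<close> limits the length of every run, so a longest one exists; it
    must cover \<open>P\<close>, as otherwise it could be extended.\<close>
  define n where "n = (GREATEST n. \<exists>x. good n x)"
  have "\<exists>x. good n x" and greatest: "\<And>l x. good l x \<Longrightarrow> l \<le> n"
  proof -
    have le: "l \<le> nat \<lfloor>m * measure N (space N) / \<kappa>\<rfloor>" if "\<exists>x. good l x" for l
      using bound that \<kappa> by (auto simp: le_nat_floor pos_le_divide_eq)
    have "\<exists>x. good 0 x" by (simp add: good_def)
    then show "\<exists>x. good n x" unfolding n_def by (rule GreatestI_nat[OF _ le])
    show "l \<le> n" if "good l x" for l x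
      unfolding n_def by (rule Greatest_le_nat[OF _ le]) (use that in blast)
  qed
  then obtain x where x: "good n x" by blast
  have cover: "P \<subseteq> (\<Union>i<n. gball (x i) (r (x i)))"
  proof (rule ccontr)
    define U where "U = P - (\<Union>i<n. gball (x i) (r (x i)))"
    assume "\<not> ?thesis"
    then have U: "U \<noteq> {}" by (auto simp: U_def)
    \<comment> \<open>The supremum of the uncovered radii is finite and positive, so some
      \<open>y\<close> exceeds half of it.\<close>
    have bdd: "bdd_above (r ` U)" using r(2) by (intro bdd_aboveI[of _ R]) (auto simp: U_def)
    obtain y0 where y0: "y0 \<in> U" using U by auto
    have "0 < r y0" using r(1) y0 by (auto simp: U_def)
    also have "\<dots> \<le> (SUP y\<in>U. r y)" using y0 bdd by (rule cSUP_upper)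
    finally have "(SUP y\<in>U. r y) / 2 < (SUP y\<in>U. r y)" by simp
    then obtain y where y: "y \<in> U" "(SUP y\<in>U. r y) / 2 < r y"
      using less_cSUP_iff[OF U bdd] by blast
    have half: "r w \<le> 2 * r y" if "w \<in> U" for w
      using cSUP_upper[OF that bdd] y by simp
    have yP: "y \<in> P" "\<And>i. i < n \<Longrightarrow> y \<notin> gball (x i) (r (x i))" using y by (auto simp: U_def)
    have "good (Suc n) (x(n := y))"
      unfolding good_def
    proof (intro conjI allI ballI impI)
      fix i assume "i < Suc n"
      then show "(x(n := y)) i \<in> P" using x yP by (auto simp: good_def less_Suc_eq)
    next
      fix j i assume "j < Suc n" "i < j"
      then show "(x(n := y)) j \<notin> gball ((x(n := y)) i) (r ((x(n := y)) i))"
        and "r ((x(n := y)) j) \<le> 2 * r ((x(n := y)) i)"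
        using x yP by (auto simp: good_def less_Suc_eq simp del: mem_gball)
    next
      fix w i assume w: "w \<in> P" "\<forall>i<Suc n. w \<notin> gball ((x(n := y)) i) (r ((x(n := y)) i))"
        and i: "i < Suc n"
      have w': "w \<notin> gball (x i) (r (x i))" if "i < n" for i
        using w(2)[rule_format, of i] that by (simp del: mem_gball)
      then have "w \<in> U" using w(1) by (auto simp: U_def)
      then show "r w \<le> 2 * r ((x(n := y)) i)"
        using x w(1) w' i half by (auto simp: good_def less_Suc_eq simp del: mem_gball)
    qed
    then show False using greatest by (meson Suc_n_not_le_n)
  qed
  have "real (card (x ` {..<n})) * \<kappa> \<le> real n * \<kappa>"
    using \<kappa> card_image_le[of "{..<n}" x] by simp
  also note bound[OF x]
  finally have "real (card (x ` {..<n})) * \<kappa> \<le> m * measure N (space N)" .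
  moreover have "x ` {..<n} \<subseteq> P" using x by (auto simp: good_def)
  ultimately show thesis using that[of "x ` {..<n}"] cover by (simp add: m_def)
qed

end

subsection \<open>Balls of prescribed mass\<close>

context asymmetric_norm
begin

text \<open>A point of the sphere can be pushed radially out of the ball. Non-degeneracy, a
  condition on frontiers, thereby applies to level sets of \<open>g\<close>.\<close>

lemma gsphere_subset_frontier:
  assumes "0 < t"
  shows "{y. g (y - x) = t} \<subseteq> frontier (gball x t)"
proof
  fix y assume "y \<in> {y. g (y - x) = t}"
  then have y: "g (y - x) = t" by simp
  have "y \<notin> interior (gball x t)"
  proof
    assume "y \<in> interior (gball x t)"
    then obtain e where e: "0 < e" "cball y e \<subseteq> gball x t" using mem_interior_cball by blast
    have n: "0 < norm (y - x)" using y assms by auto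
    define \<delta> where "\<delta> = e / norm (y - x)"
    have \<delta>: "0 < \<delta>" using e n by (simp add: \<delta>_def)
    have "y + \<delta> *\<^sub>R (y - x) \<in> cball y e" using n e by (simp add: dist_norm \<delta>_def)
    then have "g (y + \<delta> *\<^sub>R (y - x) - x) \<le> t" using e by auto
    moreover have "y + \<delta> *\<^sub>R (y - x) - x = (1 + \<delta>) *\<^sub>R (y - x)" by (simp add: algebra_simps)
    ultimately have "(1 + \<delta>) * t \<le> t" using scale[of "1 + \<delta>" "y - x"] \<delta> y by simp
    then show False using mult_pos_pos[OF \<delta> assms] by (simp add: distrib_right)
  qed
  moreover have "y \<in> closure (gball x t)" using y closure_subset by fastforce
  ultimately show "y \<in> frontier (gball x t)" by (simp add: frontier_def)
qed

text \<open>Let \<open>t\<close> be the first distance at which the closed ball holds more than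
  \<open>k\<close> points. The sphere there carries at most \<open>k / 2\<close> of them, so the
  open ball retains at least \<open>k / 2\<close>, yet at most \<open>k\<close>.\<close>

lemma exists_radius_card:
  assumes "finite S" "0 < k" "k < card S"
    and sphere: "\<And>t. 0 < t \<Longrightarrow> real (card {y \<in> S. g (y - x) = t}) \<le> real k / 2"
  obtains r where "0 < r" "card (S \<inter> gball x r) \<le> k" "real k / 2 \<le> real (card (S \<inter> gball x r))"
proof -
  define h where "h y = g (y - x)" for y
  have h: "0 \<le> h y" for y by (simp add: h_def nonneg)
  define T where "T = {t \<in> h ` S. k < card {y \<in> S. h y \<le> t}}"
  have finT: "finite T" using assms(1) by (simp add: T_def)
  have "S \<noteq> {}" using assms(3) by auto
  then have "Max (h ` S) \<in> h ` S" using assms(1) by (intro Max_in) auto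
  moreover have "{y \<in> S. h y \<le> Max (h ` S)} = S" using assms(1) by auto
  ultimately have "Max (h ` S) \<in> T" using assms(3) by (simp add: T_def)
  then have "T \<noteq> {}" by blast
  define t where "t = Min T"
  have t: "t \<in> T" "\<And>s. s \<in> T \<Longrightarrow> t \<le> s" using finT \<open>T \<noteq> {}\<close> by (auto simp: t_def)
  then have big: "k < card {y \<in> S. h y \<le> t}" by (simp add: T_def)
  \<comment> \<open>A ball of radius \<open>0\<close> contains only \<open>x\<close>, which cannot
    exceed \<open>k \<ge> 1\<close> points.\<close>
  have t0: "0 < t"
  proof (rule ccontr)
    assume "\<not> 0 < t"
    then have "{y \<in> S. h y \<le> t} \<subseteq> {x}"
      using h by (auto simp: h_def) (metis antisym_conv eq_zero eq_iff_diff_eq_0 nonneg not_less order_trans)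
    then have "card {y \<in> S. h y \<le> t} \<le> 1" using card_mono[of "{x}"] by fastforce
    then show False using big assms(2) by simp
  qed
  define L where "L = {y \<in> S. h y < t}"
  have finL: "finite L" using assms(1) by (simp add: L_def)
  have "{y \<in> S. h y \<le> t} = L \<union> {y \<in> S. h y = t}" by (auto simp: L_def)
  then have "card {y \<in> S. h y \<le> t} \<le> card L + card {y \<in> S. h y = t}" by (simp add: card_Un_le)
  then have L_ge: "real k / 2 < real (card L)"
    using big sphere[OF t0] unfolding h_def by linarith
  then have "L \<noteq> {}" using assms(2) by auto
  define s where "s = Max (h ` L)"
  have "s \<in> h ` L" unfolding s_def using finL \<open>L \<noteq> {}\<close> by (intro Max_in) auto
  then have s: "s \<in> h ` S" "s < t" "0 \<le> s" using h by (auto simp: L_def)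
  have Ls: "h y \<le> s" if "y \<in> L" for y using that finL by (simp add: s_def)
  have "s \<notin> T" using s(2) t(2) by fastforce
  then have "card {y \<in> S. h y \<le> s} \<le> k" using s(1) by (simp add: T_def)
  moreover have "card L \<le> card {y \<in> S. h y \<le> s}"
    using assms(1) Ls by (intro card_mono) (auto simp: L_def)
  ultimately have L_le: "card L \<le> k" by simp
  \<comment> \<open>No point of \<open>S\<close> has distance strictly between \<open>s\<close> and
    \<open>t\<close>, so this closed ball has the points of the open ball of radius
    \<open>t\<close>. The midpoint is positive even if \<open>s = 0\<close>.\<close>
  have "S \<inter> gball x ((s + t) / 2) = L"
  proof (intro set_eqI iffI)
    fix y assume "y \<in> S \<inter> gball x ((s + t) / 2)"
    then show "y \<in> L" using s by (auto simp: L_def h_def)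
  next
    fix y assume "y \<in> L"
    then show "y \<in> S \<inter> gball x ((s + t) / 2)" using Ls[of y] s by (auto simp: L_def h_def)
  qed
  then show thesis using that[of "(s + t) / 2"] s L_le L_ge by simp
qed

text \<open>The mass of a ball as a function of its radius is the distribution function of
  \<open>h\<close>. Null spheres make it continuous, so it takes the value \<open>k\<close>
  exactly.\<close>

lemma exists_radius_measure:
  assumes "finite_measure \<mu>" and sets: "sets \<mu> = sets borel" and k: "0 < k" "k < measure \<mu> UNIV"
    and sphere: "\<And>t. measure \<mu> {y. g (y - x) = t} = 0"
  obtains r where "0 < r" "measure \<mu> (gball x r) = k"
proof -
  interpret finite_measure \<mu> by fact
  have space: "space \<mu> = UNIV" using sets_eq_imp_space_eq[OF sets] by simp
  define h where "h y = g (y - x)" for y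
  have "continuous_on UNIV h"
    unfolding h_def
    by (rule continuous_on_compose2[OF continuous_on_gauge[of UNIV]]) (auto intro!: continuous_intros)
  then have h: "h \<in> borel_measurable \<mu>"
    using borel_measurable_continuous_onI measurable_cong_sets[OF sets] by blast
  define M where "M = distr \<mu> borel h"
  interpret M: finite_borel_measure M
    unfolding M_def finite_borel_measure_def finite_borel_measure_axioms_def
    using finite_measure_distr[OF h] by simp
  have "measure M {t} = 0" for t
    using sphere[of t] h by (simp add: M_def measure_distr space vimage_def h_def)
  then have cont: "isCont (cdf M) t" for t by (simp add: M.isCont_cdf)
  have cdf_eq: "cdf M t = measure \<mu> (gball x t)" for t
    using h by (simp add: M_def cdf_def measure_distr space vimage_def h_def gball_def)
  have "measure M (space M) = measure \<mu> UNIV"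
    using h by (simp add: M_def measure_distr space)
  then have "eventually (\<lambda>t. k < cdf M t) at_top"
    using M.cdf_lim_at_top k by (intro order_tendstoD) auto
  then obtain b where b: "k < cdf M b" by (metis eventually_happens' trivial_limit_at_top_linorder)
  have "gball x 0 = {y. g (y - x) = 0}"
    using nonneg by (auto simp: gball_def intro: antisym)
  then have zero: "cdf M 0 = 0" using sphere[of 0] by (simp add: cdf_eq)
  then have b0: "0 < b" using b k M.cdf_nondecreasing[of b 0] by (cases "b \<le> 0") auto
  obtain r where r: "0 \<le> r" "r \<le> b" "cdf M r = k"
    using IVT[of "cdf M" 0 k b] zero k b b0 cont by auto
  moreover have "r \<noteq> 0" using r zero k by auto
  ultimately show thesis using that[of r] by (simp add: cdf_eq)
qed

section \<open>Covers by balls of mass at most \<open>k\<close>\<close>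

lemma bounded_subset_gball:
  assumes "bounded S"
  obtains R where "0 < R" "\<And>x. x \<in> S \<Longrightarrow> S \<subseteq> gball x R"
proof -
  obtain b where b: "0 < b" "\<And>y. y \<in> S \<Longrightarrow> norm y \<le> b" using assms bounded_pos by blast
  have "g (y - x) \<le> B * (2 * b)" if "x \<in> S" "y \<in> S" for x y
  proof -
    have "norm (y - x) \<le> 2 * b" using norm_triangle_ineq4[of y x] b(2)[OF that(1)] b(2)[OF that(2)] by simp
    then have "B * norm (y - x) \<le> B * (2 * b)" using B_pos by simp
    then show ?thesis using upper[of "y - x"] by simp
  qed
  then have "S \<subseteq> gball x (B * (2 * b))" if "x \<in> S" for x using that by auto
  then show thesis using that[of "B * (2 * b)"] B_pos b(1) by simp
qed

lemma set_cover:
  assumes "finite S" "0 < k" "k \<le> card S"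
    and sphere: "\<And>x t. 0 < t \<Longrightarrow> real (card {y \<in> S. g (y - x) = t}) \<le> real k / 2"
  obtains F r where "finite F" "S \<subseteq> (\<Union>x\<in>F. gball x (r x))"
    "\<And>x. x \<in> F \<Longrightarrow> 0 < r x" "\<And>x. x \<in> F \<Longrightarrow> card (S \<inter> gball x (r x)) \<le> k"
    "real (card F) \<le> 2 * ((16 * D) ^ DIM('a) * (4 * D + 1)) * real (card S) / real k"
proof (cases "k = card S")
  \<comment> \<open>Here no ball need stop short of the total: one large ball suffices, and the
    constant is at least \<open>1\<close>.\<close>
  case True
  obtain R where R: "0 < R" "\<And>x. x \<in> S \<Longrightarrow> S \<subseteq> gball x R"
    using bounded_subset_gball finite_imp_bounded[OF assms(1)] by blast
  obtain x where x: "x \<in> S" using assms by fastforce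
  have "1 * 1 \<le> (16 * D) ^ DIM('a) * (4 * D + 1)"
    using D1 by (intro mult_mono one_le_power) auto
  then have "real (card {x}) \<le> 2 * ((16 * D) ^ DIM('a) * (4 * D + 1)) * real (card S) / real k"
    using True assms(2) by simp
  then show thesis
    using R x True assms(1) by (intro that[of "{x}" "\<lambda>_. R"]) (auto intro: card_mono)
next
  case False
  then have k: "k < card S" using assms by simp
  have "\<exists>r. 0 < r \<and> card (S \<inter> gball x r) \<le> k \<and> real k / 2 \<le> real (card (S \<inter> gball x r))" for x
    using exists_radius_card[OF assms(1,2) k sphere] by metis
  then obtain r where r: "\<And>x. 0 < r x" "\<And>x. card (S \<inter> gball x (r x)) \<le> k"
    "\<And>x. real k / 2 \<le> real (card (S \<inter> gball x (r x)))" by metis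
  have bd: "r x \<le> Max (r ` S)" if "x \<in> S" for x using that assms(1) by simp
  have meas: "measure (count_space S) (gball x (r x) \<inter> space (count_space S))
      = real (card (S \<inter> gball x (r x)))" for x
    using assms(1) by (subst measure_count_space) (auto simp: Int_commute)
  \<comment> \<open>The guaranteed mass per ball is \<open>k / 2\<close>; this is the origin of the
    factor \<open>2\<close>.\<close>
  obtain F where F: "finite F" "F \<subseteq> S" "S \<subseteq> (\<Union>x\<in>F. gball x (r x))"
    "real (card F) * (real k / 2)
      \<le> (16 * D) ^ DIM('a) * (4 * D + 1) * measure (count_space S) (space (count_space S))"
    by (rule besicovitch_cover[of "count_space S" "real k / 2" S r "Max (r ` S)"])
      (use assms r bd meas in \<open>auto simp: finite_measure_count_space simp del: mem_gball\<close>)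
  have "real (card F) \<le> 2 * ((16 * D) ^ DIM('a) * (4 * D + 1)) * real (card S) / real k"
    using F(4) assms by (simp add: pos_le_divide_eq mult_ac)
  then show thesis using that[OF F(1,3)] r by blast
qed

lemma measure_cover:
  assumes "finite_measure \<mu>" and sets: "sets \<mu> = sets borel"
    and k: "0 < k" "k \<le> measure \<mu> UNIV"
    and K: "bounded K" "K \<noteq> {}" "K \<in> sets borel" "measure \<mu> K = measure \<mu> UNIV"
    and sphere: "\<And>x t. measure \<mu> {y. g (y - x) = t} = 0"
  obtains F r where "finite F" "K \<subseteq> (\<Union>x\<in>F. gball x (r x))"
    "\<And>x. x \<in> F \<Longrightarrow> 0 < r x" "\<And>x. x \<in> F \<Longrightarrow> measure \<mu> (gball x (r x)) \<le> k"
    "real (card F) \<le> 2 * ((16 * D) ^ DIM('a) * (4 * D + 1)) * measure \<mu> UNIV / k"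
proof -
  interpret finite_measure \<mu> by fact
  have space: "space \<mu> = UNIV" using sets_eq_imp_space_eq[OF sets] by simp
  have gb: "gball x r \<in> sets \<mu>" for x r
    using borel_closed[OF closed_gball] by (simp add: sets)
  obtain R where R: "0 < R" "\<And>x. x \<in> K \<Longrightarrow> K \<subseteq> gball x R"
    using bounded_subset_gball K(1) by blast
  have full: "measure \<mu> (gball x R) = measure \<mu> UNIV" if "x \<in> K" for x
  proof (rule antisym)
    show "measure \<mu> (gball x R) \<le> measure \<mu> UNIV" using bounded_measure space by metis
    show "measure \<mu> UNIV \<le> measure \<mu> (gball x R)"
      using finite_measure_mono[OF R(2)[OF that] gb] K by simp
  qed
  have one: "1 * 1 \<le> (16 * D) ^ DIM('a) * (4 * D + 1)"
    using D1 by (intro mult_mono one_le_power) auto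
  show thesis
  proof (cases "k = measure \<mu> UNIV")
    case True
    obtain x where x: "x \<in> K" using K by blast
    show thesis using that[of "{x}" "\<lambda>_. R"] R x full[OF x] True k one by simp
  next
    case False
    then have k': "k < measure \<mu> UNIV" using k by simp
    have "\<exists>r. 0 < r \<and> measure \<mu> (gball x r) = k" for x
      using exists_radius_measure[OF assms(1,2) k(1) k' sphere] by metis
    then obtain r where r: "\<And>x. 0 < r x" "\<And>x. measure \<mu> (gball x (r x)) = k" by metis
    \<comment> \<open>A radius above \<open>R\<close> would give the ball the full mass, which
      exceeds \<open>k\<close>.\<close>
    have bd: "r x \<le> R" if "x \<in> K" for x
    proof (rule ccontr)
      assume "\<not> r x \<le> R"
      then have "gball x R \<subseteq> gball x (r x)" by auto
      then have "measure \<mu> (gball x R) \<le> measure \<mu> (gball x (r x))"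
        by (rule finite_measure_mono[OF _ gb])
      then show False using full[OF that] r(2)[of x] k' by linarith
    qed
    obtain F where F: "finite F" "F \<subseteq> K" "K \<subseteq> (\<Union>x\<in>F. gball x (r x))"
      "real (card F) * k \<le> (16 * D) ^ DIM('a) * (4 * D + 1) * measure \<mu> (space \<mu>)"
      by (rule besicovitch_cover[of \<mu> k K r R])
        (use assms r bd gb space in \<open>auto simp del: mem_gball\<close>)
    have "real (card F) \<le> (16 * D) ^ DIM('a) * (4 * D + 1) * measure \<mu> UNIV / k"
      using F(4) k by (simp add: pos_le_divide_eq space)
    \<comment> \<open>The balls have mass exactly \<open>k\<close>; the factor \<open>2\<close> is
      inserted so that both halves share one constant.\<close>
    also have "\<dots> \<le> 2 * ((16 * D) ^ DIM('a) * (4 * D + 1)) * measure \<mu> UNIV / k"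
      using D1 k by (intro divide_right_mono mult_right_mono) auto
    finally show thesis using that[OF F(1,3)] r by simp
  qed
qed

end

section \<open>From ball covers to the covering numbers\<close>

lemma f_set_le:
  assumes "finite F" "\<And>x. x \<in> F \<Longrightarrow> is_homothet C (H x) \<and> card (S \<inter> H x) \<le> k" "S \<subseteq> (\<Union>x\<in>F. H x)"
  shows "f_set C k S \<le> card F"
proof -
  have "f_set C k S \<le> card (H ` F)"
    unfolding f_set_def by (rule Least_le, rule exI[of _ "H ` F"]) (use assms in auto)
  then show ?thesis using card_image_le[OF assms(1), of H] by simp
qed

lemma f_meas_le:
  assumes "finite F" "\<And>x. x \<in> F \<Longrightarrow> is_homothet C (H x) \<and> emeasure \<mu> (H x) \<le> ennreal k"
    "K \<subseteq> (\<Union>x\<in>F. H x)"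
  shows "f_meas C k \<mu> K \<le> card F"
proof -
  have "f_meas C k \<mu> K \<le> card (H ` F)"
    unfolding f_meas_def by (rule Least_le, rule exI[of _ "H ` F"]) (use assms in auto)
  then show ?thesis using card_image_le[OF assms(1), of H] by simp
qed

theorem mainTheorem2:
  shows "\<exists>c::real. \<forall>C::('a::euclidean_space) set. convex_body C \<longrightarrow>
    (\<forall>(k::nat) S. k > 0 \<longrightarrow> finite S \<longrightarrow> non_degenerate_set C (real k / 2) S \<longrightarrow>
        card S \<ge> k \<longrightarrow> real (f_set C k S) \<le> c * real (card S) / real k) \<and>
    (\<forall>(k::real) (\<mu>::'a measure) K. k > 0 \<longrightarrow> nice_measure C \<mu> K \<longrightarrow>
        emeasure \<mu> (space \<mu>) \<ge> ennreal k \<longrightarrow>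
        real (f_meas C k \<mu> K) \<le> c * measure \<mu> (space \<mu>) / k)"
proof -
  define d where "d = real DIM('a)"
  \<comment> \<open>The asymmetry \<open>D\<close> is replaced by the dimension, so the constant is
    fixed before \<open>C\<close> is.\<close>
  define c where "c = 2 * ((16 * d) ^ DIM('a) * (4 * d + 1))"
  show ?thesis
  proof (rule exI[of _ c], intro allI impI conjI)
    fix C :: "'a set" and k :: nat and S
    assume C: "convex_body C" and k: "0 < k" and S: "finite S" "k \<le> card S"
      and nd: "non_degenerate_set C (real k / 2) S"
    obtain g B p where g: "asymmetric_norm g d B"
      and ball: "\<And>x r. 0 < r \<Longrightarrow> {y. g (y - x) \<le> r} = homothet C r (x - r *\<^sub>R p)"
      using convex_body_gauge[OF C] unfolding d_def by blast
    interpret asymmetric_norm g d B by fact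
    have hom: "is_homothet C (gball x r)" if "0 < r" for x r
      using that ball unfolding is_homothet_def gball_def by blast
    have sphere: "real (card {y \<in> S. g (y - x) = t}) \<le> real k / 2" if t: "0 < t" for x t
    proof -
      have "{y \<in> S. g (y - x) = t} \<subseteq> S \<inter> frontier (gball x t)"
        using gsphere_subset_frontier[OF t] by blast
      then have "card {y \<in> S. g (y - x) = t} \<le> card (S \<inter> frontier (gball x t))"
        using S by (intro card_mono) auto
      moreover have "real (card (S \<inter> frontier (gball x t))) \<le> real k / 2"
        using nd hom[OF t] unfolding non_degenerate_set_def by blast
      ultimately show ?thesis by linarith
    qed
    obtain F r where F: "finite F" "S \<subseteq> (\<Union>x\<in>F. gball x (r x))"
      "\<And>x. x \<in> F \<Longrightarrow> 0 < r x" "\<And>x. x \<in> F \<Longrightarrow> card (S \<inter> gball x (r x)) \<le> k"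
      "real (card F) \<le> c * real (card S) / real k"
      using set_cover[OF S(1) k S(2) sphere] unfolding c_def by blast
    have "f_set C k S \<le> card F"
      by (rule f_set_le[OF F(1) _ F(2)]) (use hom F in blast)
    then show "real (f_set C k S) \<le> c * real (card S) / real k" using F(5) by linarith
  next
    fix C :: "'a set" and k :: real and \<mu> :: "'a measure" and K
    assume C: "convex_body C" and k: "0 < k" and nice: "nice_measure C \<mu> K"
      and large: "ennreal k \<le> emeasure \<mu> (space \<mu>)"
    have sets: "sets \<mu> = sets borel" and fin: "emeasure \<mu> (space \<mu>) < \<infinity>"
      and nd: "non_degenerate_measure C \<mu>" and eK: "emeasure \<mu> K = emeasure \<mu> (space \<mu>)"
      using nice by (auto simp: nice_measure_def)
    obtain z \<rho> where K: "0 < \<rho>" "K = cball z \<rho>" using nice by (auto simp: nice_measure_def)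
    have space: "space \<mu> = UNIV" using sets_eq_imp_space_eq[OF sets] by simp
    interpret \<mu>: finite_measure \<mu> by (rule finite_measureI) (use fin in auto)
    obtain g B p where g: "asymmetric_norm g d B"
      and ball: "\<And>x r. 0 < r \<Longrightarrow> {y. g (y - x) \<le> r} = homothet C r (x - r *\<^sub>R p)"
      using convex_body_gauge[OF C] unfolding d_def by blast
    interpret asymmetric_norm g d B by fact
    have hom: "is_homothet C (gball x r)" if "0 < r" for x r
      using that ball unfolding is_homothet_def gball_def by blast
    have front: "A \<subseteq> frontier (gball x t) \<Longrightarrow> measure \<mu> A = 0" if t: "0 < t" for A x t
    proof -
      assume A: "A \<subseteq> frontier (gball x t)"
      have "emeasure \<mu> (frontier (gball x t)) = 0"
        using nd hom[OF t] unfolding non_degenerate_measure_def by blast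
      moreover have "frontier (gball x t) \<in> sets \<mu>" by (simp add: sets borel_closed)
      ultimately have "emeasure \<mu> A = 0" using emeasure_mono[OF A, of \<mu>] by simp
      then show "measure \<mu> A = 0" by (simp add: measure_def)
    qed
    have sphere: "measure \<mu> {y. g (y - x) = t} = 0" for x t
    proof -
      consider "0 < t" | "t = 0" | "t < 0" by linarith
      then show ?thesis
      proof cases
        case 1
        then show ?thesis using front gsphere_subset_frontier by blast
      next
        case 2
        \<comment> \<open>The sphere of radius \<open>0\<close> is the point \<open>x\<close>, which
          is null because it lies on the frontier of the ball around \<open>x - b\<close> of radius
          \<open>g b\<close>.\<close>
        obtain b :: 'a where "b \<in> Basis" using nonempty_Basis by blast
        then have b: "0 < g b" using nonneg[of b] eq_zero[of b] by (auto simp: less_le)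
        then have "x \<in> {y. g (y - (x - b)) = g b}" by simp
        then have "{x} \<subseteq> frontier (gball (x - b) (g b))" using gsphere_subset_frontier[OF b] by blast
        moreover have "{y. g (y - x) = t} = {x}" using 2 by (auto simp: eq_zero)
        ultimately show ?thesis using front[OF b] by simp
      next
        case 3
        then have "g (y - x) \<noteq> t" for y using nonneg[of "y - x"] by linarith
        then show ?thesis by simp
      qed
    qed
    have k_le: "k \<le> measure \<mu> UNIV"
      using large k by (simp add: \<mu>.emeasure_eq_measure space)
    have mK: "measure \<mu> K = measure \<mu> UNIV" using eK by (simp add: measure_def space)
    have K_props: "bounded K" "K \<noteq> {}" "K \<in> sets borel" using K by auto
    obtain F r where F: "finite F" "K \<subseteq> (\<Union>x\<in>F. gball x (r x))"
      "\<And>x. x \<in> F \<Longrightarrow> 0 < r x" "\<And>x. x \<in> F \<Longrightarrow> measure \<mu> (gball x (r x)) \<le> k"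
      "real (card F) \<le> c * measure \<mu> UNIV / k"
      using measure_cover[OF \<mu>.finite_measure_axioms sets k k_le K_props mK sphere]
      unfolding c_def by blast
    have "f_meas C k \<mu> K \<le> card F"
    proof (rule f_meas_le[OF F(1) _ F(2)])
      fix x assume "x \<in> F"
      then show "is_homothet C (gball x (r x)) \<and> emeasure \<mu> (gball x (r x)) \<le> ennreal k"
        using hom F(3,4) by (auto simp: \<mu>.emeasure_eq_measure intro!: ennreal_leI)
    qed
    then show "real (f_meas C k \<mu> K) \<le> c * measure \<mu> (space \<mu>) / k"
      using F(5) by (simp add: space)
  qed
qed

end
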